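(* Let $(E,e)$ be an order-unit Banach space. Then $E^*$ (ordered by the dual cone) is a lattice if and only if any pair of $2$-outcome measurements $(a_j)_{j=1}^2$ and $(b_k)_{k=1}^2$ on $(E,e)$ are compatible.
   Context: All linear spaces are over $\mathbb{R}$. An order-unit Banach space is a pair $(E,e)$ where $E$ is an Archimedean ordered linear space with positive cone $E_+$ and $e\in E$ is an order unit (for every $a\in E$ there is $\lambda>0$ with $-\lambda e\le a\le\lambda e$) such that the order-unit norm $\|a\|=\inf\{\lambda>0 : -\lambda e\le a\le \lambda e\}$ is complete. Archimedean means: if $na\le e$ for all $n\in\mathbb{N}$ then $a\le 0$. The Banach dual $E^*$ is ordered by the dual positive cone $E^*_+=\{\phi\in E^* : \phi(a)\ge 0\ \forall a\in E_+\}$. An $m$-outcome measurement on $(E,e)$ is a finite sequence $(a_j)_{j=1}^m\in E^m$ with $a_j\ge 0$ for all $j$ and $\sum_{j=1}^m a_j=e$. Two measurements $(a_j)_{j=1}^m$ and $(b_k)_{k=1}^n$ on $(E,e)$ are called compatible if there exists a family $(c_{j,k})_{1\le j\le m,\,1\le k\le n}$ in $E$ such that $c_{j,k}\ge 0$, $a_j=\sum_{k'=1}^n c_{j,k'}$ and $b_k=\sum_{j'=1}^m c_{j',k}$ for all $1\le j\le m$, $1\le k\le n$. *)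

theory Defs
  imports "HOL-Analysis.Analysis" "HOL-Algebra.Lattice"
begin

text \<open>
  The ordered linear space is a type of class \<open>ordered_real_vector\<close> with positive cone
  \<open>{a. 0 \<le> a}\<close>. The assumption \<open>norm_eq\<close> says that the norm of the type is the order-unit
  norm, so that its completeness is expressed by the class \<open>banach\<close>.
\<close>

locale order_unit_banach_space =
  fixes e :: "'a::{banach, ordered_real_vector}"
  assumes archimedean: "(\<forall>n::nat. real n *\<^sub>R a \<le> e) \<Longrightarrow> a \<le> 0"
    and order_unit: "\<exists>l>0. - (l *\<^sub>R e) \<le> a \<and> a \<le> l *\<^sub>R e"
    and norm_eq: "norm a = Inf {l. 0 < l \<and> - (l *\<^sub>R e) \<le> a \<and> a \<le> l *\<^sub>R e}"

definition dual_cone :: "('a::{real_normed_vector, ordered_real_vector} \<Rightarrow>\<^sub>L real) set" where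
  "dual_cone = {\<phi>. \<forall>a\<ge>0. 0 \<le> blinfun_apply \<phi> a}"

definition ordered_dual :: "('a::{real_normed_vector, ordered_real_vector} \<Rightarrow>\<^sub>L real) gorder" where
  "ordered_dual = \<lparr>carrier = UNIV, eq = (=), le = (\<lambda>\<phi> \<psi>. \<psi> - \<phi> \<in> dual_cone)\<rparr>"

text \<open>
  A finite sequence of length \<open>m\<close> is a function on \<open>nat\<close> of which only the values on
  \<open>{1..m}\<close> matter.
\<close>

definition measurement :: "'a::ordered_real_vector \<Rightarrow> nat \<Rightarrow> (nat \<Rightarrow> 'a) \<Rightarrow> bool" where
  "measurement e m a \<longleftrightarrow> (\<forall>j\<in>{1..m}. 0 \<le> a j) \<and> (\<Sum>j=1..m. a j) = e"

definition compatible ::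
    "nat \<Rightarrow> (nat \<Rightarrow> 'a::ordered_real_vector) \<Rightarrow> nat \<Rightarrow> (nat \<Rightarrow> 'a) \<Rightarrow> bool" where
  "compatible m a n b \<longleftrightarrow>
    (\<exists>c :: nat \<Rightarrow> nat \<Rightarrow> 'a.
      (\<forall>j\<in>{1..m}. \<forall>k\<in>{1..n}. 0 \<le> c j k) \<and>
      (\<forall>j\<in>{1..m}. a j = (\<Sum>k'=1..n. c j k')) \<and>
      (\<forall>k\<in>{1..n}. b k = (\<Sum>j'=1..m. c j' k)))"

end

theory Submission
  imports Defs
begin

text \<open>
  Two effects \<open>a\<close>, \<open>b\<close> are compatible iff some \<open>c\<close> satisfies \<open>0, a + b - e \<le> c \<le> a, b\<close>.

  If all pairs of effects are compatible, then \<open>b \<mapsto> sup {\<phi> d | 0 \<le> d \<le> b}\<close> is additive on the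
  positive cone, because splitting along an effect that nearly maximises \<open>\<phi>\<close> nearly attains the
  supremum for every \<open>b\<close> at once. It therefore extends to the positive part of \<open>\<phi>\<close>, and the dual
  is a lattice.

  Conversely, if the dual is a lattice, the Hahn-Banach theorem and Riesz decomposition in the dual
  yield interpolants up to an arbitrarily small multiple of \<open>e\<close>. Adding the bounds
  \<open>z \<plusminus> \<epsilon> e\<close> given by an approximate interpolant \<open>z\<close> produces a better one nearby, and the
  resulting Cauchy sequence converges to an exact interpolant.
\<close>

section \<open>Sublinear functionals\<close>

text \<open>Homogeneity is demanded only as an inequality, which infima inherit easily; scaling by
  the inverse factor then gives equality.\<close>

definition sublinear :: "('v::real_vector \<Rightarrow> real) \<Rightarrow> bool" where
  "sublinear p \<longleftrightarrow> p 0 = 0 \<and> (\<forall>x y. p (x + y) \<le> p x + p y) \<and> (\<forall>c>0. \<forall>x. p (c *\<^sub>R x) \<le> c * p x)"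

lemma sublinear_zero: "sublinear p \<Longrightarrow> p 0 = 0"
  and sublinear_add: "sublinear p \<Longrightarrow> p (x + y) \<le> p x + p y"
  and sublinear_scale_le: "sublinear p \<Longrightarrow> 0 < c \<Longrightarrow> p (c *\<^sub>R x) \<le> c * p x"
  by (simp_all add: sublinear_def)

lemma sublinear_scale:
  assumes "sublinear p" "0 \<le> c"
  shows "p (c *\<^sub>R x) = c * p x"
proof (cases "c = 0")
  case True
  then show ?thesis using assms by (simp add: sublinear_zero)
next
  case False
  then have c: "0 < c" using assms by simp
  have "p (inverse c *\<^sub>R (c *\<^sub>R x)) \<le> inverse c * p (c *\<^sub>R x)"
    using assms(1) c by (intro sublinear_scale_le) auto
  then have "c * p x \<le> p (c *\<^sub>R x)" using c by (simp add: field_simps)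
  then show ?thesis using sublinear_scale_le[OF assms(1) c, of x] by simp
qed

text \<open>It suffices that sums and positive multiples of members dominate a member of the
  appropriate set. This serves tilts, infima of chains and the defect of interpolation.\<close>

lemma sublinear_Inf:
  fixes S :: "'v::real_vector \<Rightarrow> real set"
  assumes ne: "\<And>x. S x \<noteq> {}" and bdd: "\<And>x. bdd_below (S x)"
    and zero: "0 \<in> S 0" "\<And>s. s \<in> S 0 \<Longrightarrow> 0 \<le> s"
    and add: "\<And>x y s t. s \<in> S x \<Longrightarrow> t \<in> S y \<Longrightarrow> \<exists>r\<in>S (x + y). r \<le> s + t"
    and scale: "\<And>c x t. 0 < c \<Longrightarrow> t \<in> S x \<Longrightarrow> \<exists>r\<in>S (c *\<^sub>R x). r \<le> c * t"
  shows "sublinear (\<lambda>x. Inf (S x))"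
  unfolding sublinear_def
proof (intro conjI allI impI)
  show "Inf (S 0) = 0"
    using zero by (intro antisym cInf_lower cInf_greatest bdd ne) auto
next
  fix x y
  have "Inf (S (x + y)) - t \<le> s" if "s \<in> S x" "t \<in> S y" for s t
    using add[OF that] cInf_lower[OF _ bdd, of _ "x + y"] by (meson diff_le_eq order_trans)
  then have "Inf (S (x + y)) - t \<le> Inf (S x)" if "t \<in> S y" for t
    using that by (intro cInf_greatest ne)
  then have "Inf (S (x + y)) - Inf (S x) \<le> t" if "t \<in> S y" for t
    using that by (simp add: algebra_simps)
  then have "Inf (S (x + y)) - Inf (S x) \<le> Inf (S y)"
    by (intro cInf_greatest ne)
  then show "Inf (S (x + y)) \<le> Inf (S x) + Inf (S y)" by simp
next
  fix c :: real and x
  assume c: "0 < c"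
  have "Inf (S (c *\<^sub>R x)) / c \<le> t" if "t \<in> S x" for t
  proof -
    have "Inf (S (c *\<^sub>R x)) \<le> c * t"
      using scale[OF c that] cInf_lower[OF _ bdd, of _ "c *\<^sub>R x"] by (meson order_trans)
    then show ?thesis using c by (simp add: field_simps)
  qed
  then have "Inf (S (c *\<^sub>R x)) / c \<le> Inf (S x)" by (intro cInf_greatest ne)
  then show "Inf (S (c *\<^sub>R x)) \<le> c * Inf (S x)" using c by (simp add: field_simps)
qed

text \<open>\<open>q x\<close> is the infimum of these bounds over \<open>t\<close>. From
  \<open>t = 0\<close> comes \<open>q \<le> p\<close>, and from \<open>t = 1\<close> at
  \<open>- y\<close> comes \<open>q (- y) \<le> - p y\<close>.\<close>

lemma sublinear_tilt:
  fixes p :: "'v::real_vector \<Rightarrow> real"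
  assumes p: "sublinear p"
  obtains q where "sublinear q" "\<And>x t. 0 \<le> t \<Longrightarrow> q x \<le> p (x + t *\<^sub>R y) - t * p y"
proof
  define S where "S = (\<lambda>x. {p (x + t *\<^sub>R y) - t * p y |t. 0 \<le> t})"
  have bdd: "bdd_below (S x)" for x
  proof (rule bdd_belowI[of _ "- p (- x)"])
    fix s assume "s \<in> S x"
    then obtain t where t: "0 \<le> t" "s = p (x + t *\<^sub>R y) - t * p y" by (auto simp: S_def)
    \<comment> \<open>The left side equals \<open>t * p y\<close>, so the lower bound is uniform in
      \<open>t\<close>.\<close>
    have "p ((x + t *\<^sub>R y) + - x) \<le> p (x + t *\<^sub>R y) + p (- x)" by (rule sublinear_add[OF p])
    then show "- p (- x) \<le> s" using t by (simp add: sublinear_scale[OF p])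
  qed
  show "sublinear (\<lambda>x. Inf (S x))"
  proof (rule sublinear_Inf)
    show "S x \<noteq> {}" for x by (auto simp: S_def)
    show "0 \<in> S 0" by (auto simp: S_def sublinear_zero[OF p] intro!: exI[of _ 0])
    show "0 \<le> s" if "s \<in> S 0" for s
      using that by (auto simp: S_def sublinear_scale[OF p])
    show "\<exists>r\<in>S (x + x'). r \<le> s + s'" if ss: "s \<in> S x" "s' \<in> S x'" for x x' s s'
    proof -
      obtain t where t: "0 \<le> t" "s = p (x + t *\<^sub>R y) - t * p y" using ss by (auto simp: S_def)
      obtain t' where t': "0 \<le> t'" "s' = p (x' + t' *\<^sub>R y) - t' * p y" using ss by (auto simp: S_def)
      have "p ((x + t *\<^sub>R y) + (x' + t' *\<^sub>R y)) \<le> p (x + t *\<^sub>R y) + p (x' + t' *\<^sub>R y)"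
        by (rule sublinear_add[OF p])
      moreover have "(x + t *\<^sub>R y) + (x' + t' *\<^sub>R y) = (x + x') + (t + t') *\<^sub>R y"
        by (simp add: algebra_simps)
      ultimately have "p ((x + x') + (t + t') *\<^sub>R y) - (t + t') * p y \<le> s + s'"
        using t t' by (simp add: algebra_simps)
      moreover have "p ((x + x') + (t + t') *\<^sub>R y) - (t + t') * p y \<in> S (x + x')"
        unfolding S_def using t(1) t'(1) by (intro CollectI exI[of _ "t + t'"]) simp
      ultimately show ?thesis by blast
    qed
    show "\<exists>r\<in>S (c *\<^sub>R x). r \<le> c * s" if c: "0 < c" and s: "s \<in> S x" for c x s
    proof -
      obtain t where t: "0 \<le> t" "s = p (x + t *\<^sub>R y) - t * p y" using s by (auto simp: S_def)
      have "c * s = p (c *\<^sub>R (x + t *\<^sub>R y)) - (c * t) * p y"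
        using t c by (simp add: sublinear_scale[OF p] right_diff_distrib mult.assoc)
      also have "\<dots> = p (c *\<^sub>R x + (c * t) *\<^sub>R y) - (c * t) * p y"
        by (simp add: algebra_simps)
      finally have "c * s \<in> S (c *\<^sub>R x)"
        unfolding S_def using t c by (intro CollectI exI[of _ "c * t"]) simp
      then show ?thesis by blast
    qed
  qed (rule bdd)
  show "Inf (S x) \<le> p (x + t *\<^sub>R y) - t * p y" if "0 \<le> t" for x t
    using that by (intro cInf_lower bdd) (auto simp: S_def)
qed

text \<open>The pointwise infimum works: for subadditivity the smaller of two members serves both
  summands, and comparison with one fixed member keeps the infimum finite.\<close>

lemma sublinear_chain_lower_bound:
  fixes C :: "('v::real_vector \<Rightarrow> real) set"
  assumes sub: "\<And>p. p \<in> C \<Longrightarrow> sublinear p" and ne: "C \<noteq> {}"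
    and chain: "\<And>p q. p \<in> C \<Longrightarrow> q \<in> C \<Longrightarrow> p \<le> q \<or> q \<le> p"
  obtains r where "sublinear r" "\<And>p. p \<in> C \<Longrightarrow> r \<le> p"
proof
  define S where "S = (\<lambda>x. (\<lambda>p. p x) ` C)"
  obtain p0 where p0: "p0 \<in> C" using ne by blast
  have bdd: "bdd_below (S x)" for x
  proof (rule bdd_belowI[of _ "- p0 (- x)"])
    fix s assume "s \<in> S x"
    then obtain p where p: "p \<in> C" "s = p x" by (auto simp: S_def)
    have *: "0 \<le> r x + r (- x)" if "r \<in> C" for r
      using sublinear_add[OF sub[OF that], of x "- x"] sublinear_zero[OF sub[OF that]] by simp
    from chain[OF p(1) p0] show "- p0 (- x) \<le> s"
    proof
      assume "p \<le> p0"
      then show ?thesis using *[OF p(1)] p(2) le_funD[of p p0 "- x"] by simp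
    next
      assume "p0 \<le> p"
      then show ?thesis using *[OF p0] p(2) le_funD[of p0 p x] by simp
    qed
  qed
  show "sublinear (\<lambda>x. Inf (S x))"
  proof (rule sublinear_Inf)
    show "S x \<noteq> {}" for x using ne by (auto simp: S_def)
    show "0 \<in> S 0" using p0 sublinear_zero[OF sub[OF p0]] by (force simp: S_def)
    show "0 \<le> s" if "s \<in> S 0" for s
      using that by (auto simp: S_def sublinear_zero[OF sub])
    show "\<exists>r\<in>S (x + y). r \<le> s + t" if st: "s \<in> S x" "t \<in> S y" for x y s t
    proof -
      obtain p q where pq: "p \<in> C" "s = p x" "q \<in> C" "t = q y" using st by (auto simp: S_def)
      from chain[OF pq(1,3)] show ?thesis
      proof
        assume "p \<le> q"
        then have "p (x + y) \<le> s + t"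
          using sublinear_add[OF sub[OF pq(1)], of x y] pq le_funD[of p q y] by simp
        then show ?thesis using pq(1) by (auto simp: S_def)
      next
        assume "q \<le> p"
        then have "q (x + y) \<le> s + t"
          using sublinear_add[OF sub[OF pq(3)], of x y] pq le_funD[of q p x] by simp
        then show ?thesis using pq(3) by (auto simp: S_def)
      qed
    qed
    show "\<exists>r\<in>S (c *\<^sub>R x). r \<le> c * t" if "0 < c" "t \<in> S x" for c x t
    proof -
      obtain p where "p \<in> C" "t = p x" using \<open>t \<in> S x\<close> by (auto simp: S_def)
      then show ?thesis
        using sublinear_scale_le[OF sub \<open>0 < c\<close>, of p x] by (auto simp: S_def)
    qed
  qed (rule bdd)
  show "(\<lambda>x. Inf (S x)) \<le> p" if "p \<in> C" for p
    using that by (intro le_funI cInf_lower bdd) (auto simp: S_def)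
qed

text \<open>Tilting along \<open>y\<close> cannot make \<open>m\<close> smaller, so the bound at
  \<open>t = 1\<close> is superadditivity.\<close>

lemma linear_if_minimal_sublinear:
  fixes m :: "'v::real_vector \<Rightarrow> real"
  assumes m: "sublinear m" and min: "\<And>q. sublinear q \<Longrightarrow> q \<le> m \<Longrightarrow> q = m"
  shows "linear m"
proof (rule linearI)
  show add: "m (x + y) = m x + m y" for x y
  proof -
    obtain q where q: "sublinear q" "\<And>x t. 0 \<le> t \<Longrightarrow> q x \<le> m (x + t *\<^sub>R y) - t * m y"
      using sublinear_tilt[OF m, of y] by blast
    have "q \<le> m" using q(2)[of 0] by (simp add: le_fun_def)
    then have "q = m" by (rule min[OF q(1)])
    then have "m x \<le> m (x + y) - m y" using q(2)[of 1 x] by simp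
    then show ?thesis using sublinear_add[OF m, of x y] by simp
  qed
  have neg: "m (- x) = - m x" for x
    using add[of x "- x"] sublinear_zero[OF m] by simp
  show "m (c *\<^sub>R x) = c *\<^sub>R m x" for c x
  proof (cases "0 \<le> c")
    case False
    then have "m ((- c) *\<^sub>R x) = - c * m x" by (intro sublinear_scale[OF m]) simp
    then show ?thesis using neg[of "c *\<^sub>R x"] by simp
  qed (simp add: sublinear_scale[OF m])
qed

text \<open>Zorn's lemma is applied below the tilt \<open>q\<close> of \<open>p\<close> along
  \<open>x0\<close>: since \<open>q (- x0) \<le> - p x0\<close>, any linear functional below
  \<open>q\<close> takes the value \<open>p x0\<close> at \<open>x0\<close>.\<close>

theorem Hahn_Banach_sublinear:
  fixes p :: "'v::real_vector \<Rightarrow> real"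
  assumes p: "sublinear p"
  obtains f where "linear f" "\<And>x. f x \<le> p x" "f x0 = p x0"
proof -
  obtain q where q: "sublinear q" "\<And>x t. 0 \<le> t \<Longrightarrow> q x \<le> p (x + t *\<^sub>R x0) - t * p x0"
    using sublinear_tilt[OF p, of x0] by blast
  have qp: "q x \<le> p x" for x using q(2)[of 0 x] by simp
  have qx0: "q (- x0) \<le> - p x0" using q(2)[of 1 "- x0"] sublinear_zero[OF p] by simp
  define A where "A = {r. sublinear r \<and> r \<le> q}"
  \<comment> \<open>With the order reversed, chains need lower bounds and a maximal element is a
    minimal functional.\<close>
  have "\<exists>m\<in>A. \<forall>r\<in>A. r \<le> m \<longrightarrow> r = m"
  proof (rule predicate_Zorn)
    show "partial_order_on A (relation_of (\<lambda>r s. s \<le> r) A)"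
      by (rule partial_order_on_relation_ofI) auto
  next
    fix C assume C: "C \<in> Chains (relation_of (\<lambda>r s. s \<le> r) A)"
    then have CA: "C \<subseteq> A" by (auto simp: Chains_def relation_of_def)
    show "\<exists>u\<in>A. \<forall>a\<in>C. u \<le> a"
    proof (cases "C = {}")
      case True
      then show ?thesis using q(1) by (auto simp: A_def)
    next
      case False
      obtain u where u: "sublinear u" "\<And>r. r \<in> C \<Longrightarrow> u \<le> r"
      proof (rule sublinear_chain_lower_bound[of C])
        show "sublinear r" if "r \<in> C" for r using that CA by (auto simp: A_def)
        show "r \<le> s \<or> s \<le> r" if "r \<in> C" "s \<in> C" for r s
          using that C by (auto simp: Chains_def relation_of_def)
      qed (use False in auto)
      obtain r where "r \<in> C" using False by blast
      then have "u \<le> q" using u(2)[of r] CA by (auto simp: A_def intro: order_trans)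
      then show ?thesis using u by (auto simp: A_def)
    qed
  qed
  then obtain m where m: "sublinear m" "m \<le> q"
    and min: "\<And>r. sublinear r \<Longrightarrow> r \<le> q \<Longrightarrow> r \<le> m \<Longrightarrow> r = m"
    by (auto simp: A_def)
  have lin: "linear m"
    using m(2) by (intro linear_if_minimal_sublinear[OF m(1)] min) auto
  have le: "m x \<le> p x" for x using le_funD[OF m(2), of x] qp[of x] by simp
  have "m (- x0) \<le> - p x0" using le_funD[OF m(2), of "- x0"] qx0 by simp
  then have "m x0 = p x0" using le[of x0] linear_neg[OF lin, of x0] by simp
  then show ?thesis using that lin le by blast
qed

section \<open>Positive parts in the dual\<close>

text \<open>\<open>p\<close> is the supremum of \<open>\<phi>\<close> and 0 in the dual. A relation
  is used because the existence of \<open>p\<close> is the question.\<close>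

definition dual_positive_part ::
    "('a::{real_normed_vector, ordered_real_vector} \<Rightarrow>\<^sub>L real) \<Rightarrow> ('a \<Rightarrow>\<^sub>L real) \<Rightarrow> bool" where
  "dual_positive_part \<phi> p \<longleftrightarrow> p \<in> dual_cone \<and> p - \<phi> \<in> dual_cone \<and>
    (\<forall>s\<in>dual_cone. s - \<phi> \<in> dual_cone \<longrightarrow> s - p \<in> dual_cone)"

lemma dual_cone_add: "\<phi> \<in> dual_cone \<Longrightarrow> \<psi> \<in> dual_cone \<Longrightarrow> \<phi> + \<psi> \<in> dual_cone"
  by (auto simp: dual_cone_def blinfun.add_left)

lemma dual_cone_nonneg: "\<phi> \<in> dual_cone \<Longrightarrow> 0 \<le> a \<Longrightarrow> 0 \<le> blinfun_apply \<phi> a"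
  by (auto simp: dual_cone_def)

lemma dual_cone_mono: "\<phi> \<in> dual_cone \<Longrightarrow> a \<le> b \<Longrightarrow> blinfun_apply \<phi> a \<le> blinfun_apply \<phi> b"
  using dual_cone_nonneg[of \<phi> "b - a"] by (simp add: blinfun.diff_right)

text \<open>Riesz decomposition: with \<open>p = (\<phi>1 - \<psi>1)\<^sup>+\<close>, the matrix with rows \<open>(\<phi>1 - p, p)\<close> and
  \<open>(\<psi>1 - \<phi>1 + p, \<psi>2 - p)\<close> is positive, with row sums \<open>\<phi>1, \<phi>2\<close> and column sums \<open>\<psi>1, \<psi>2\<close>.\<close>

lemma dual_pairing_le:
  fixes \<phi>1 \<phi>2 \<psi>1 \<psi>2 :: "'a::{real_normed_vector, ordered_real_vector} \<Rightarrow>\<^sub>L real"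
  assumes p: "dual_positive_part (\<phi>1 - \<psi>1) p"
    and pos: "\<phi>1 \<in> dual_cone" "\<phi>2 \<in> dual_cone" "\<psi>1 \<in> dual_cone" "\<psi>2 \<in> dual_cone"
    and sum: "\<phi>1 + \<phi>2 = \<psi>1 + \<psi>2"
    and le: "x1 \<le> y1" "x1 \<le> y2" "x2 \<le> y1" "x2 \<le> y2"
  shows "blinfun_apply \<phi>1 x1 + blinfun_apply \<phi>2 x2 \<le> blinfun_apply \<psi>1 y1 + blinfun_apply \<psi>2 y2"
proof -
  have min: "s - p \<in> dual_cone" if "s \<in> dual_cone" "s - (\<phi>1 - \<psi>1) \<in> dual_cone" for s
    using p that by (auto simp: dual_positive_part_def)
  \<comment> \<open>Both \<open>\<phi>1\<close> and \<open>\<psi>2\<close> are upper bounds of 0 and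
    \<open>\<phi>1 - \<psi>1\<close>, exceeding the latter by \<open>\<psi>1\<close> and
    \<open>\<phi>2\<close>. Minimality of \<open>p\<close> therefore makes the diagonal entries
    positive.\<close>
  have w11: "\<phi>1 - p \<in> dual_cone" using pos by (intro min) auto
  have w12: "p \<in> dual_cone" and w21: "p - (\<phi>1 - \<psi>1) \<in> dual_cone"
    using p by (auto simp: dual_positive_part_def)
  have eq: "\<psi>2 - (\<phi>1 - \<psi>1) = \<phi>2" using sum by (simp add: algebra_simps)
  have w22: "\<psi>2 - p \<in> dual_cone" using pos eq by (intro min) auto
  have "blinfun_apply \<phi>1 z + blinfun_apply \<phi>2 z = blinfun_apply \<psi>1 z + blinfun_apply \<psi>2 z" for z
    using arg_cong[OF sum, of "\<lambda>f. blinfun_apply f z"] by (simp add: blinfun.add_left)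
  \<comment> \<open>The entry in row i and column j is paired with \<open>xi \<le> yj\<close>; row
    sums collect on the left and column sums on the right.\<close>
  then show ?thesis
    using dual_cone_mono[OF w11 le(1)] dual_cone_mono[OF w12 le(2)]
      dual_cone_mono[OF w21 le(3)] dual_cone_mono[OF w22 le(4)]
    by (smt (verit) blinfun.diff_left)
qed

section \<open>Order-unit Banach spaces\<close>

context order_unit_banach_space
begin

section \<open>The order-unit norm\<close>

lemma unit_nonneg: "0 \<le> e"
proof -
  obtain l where l: "0 < l" "0 \<le> l *\<^sub>R e" using order_unit[of 0] by auto
  then have "0 \<le> inverse l *\<^sub>R (l *\<^sub>R e)" by (intro scaleR_nonneg_nonneg[of "inverse l"]) simp_all
  moreover have "inverse l *\<^sub>R (l *\<^sub>R e) = e" using l(1) by simp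
  ultimately show ?thesis by (simp only:)
qed

lemma scale_unit_mono: "s \<le> t \<Longrightarrow> s *\<^sub>R e \<le> t *\<^sub>R e"
  by (intro scaleR_right_mono unit_nonneg)

lemma neg_scale_unit_mono: "s \<le> t \<Longrightarrow> - (t *\<^sub>R e) \<le> - (s *\<^sub>R e)"
  using scale_unit_mono by simp

text \<open>The Archimedean axiom in the form that removes small errors: \<open>d = 1 / n\<close>
  turns the hypothesis into \<open>n (x - y) \<le> e\<close>.\<close>

lemma le_if_le_add_scale_unit:
  assumes "\<And>d. 0 < d \<Longrightarrow> x \<le> y + d *\<^sub>R e"
  shows "x \<le> y"
proof -
  have "real n *\<^sub>R (x - y) \<le> e" for n
  proof (cases "n = 0")
    case True
    then show ?thesis by (simp add: unit_nonneg)
  next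
    case False
    then have "x - y \<le> (1 / real n) *\<^sub>R e" using assms[of "1 / real n"] by (simp add: algebra_simps)
    then have "real n *\<^sub>R (x - y) \<le> real n *\<^sub>R ((1 / real n) *\<^sub>R e)" by (intro scaleR_left_mono) auto
    then show ?thesis using False by simp
  qed
  then show ?thesis using archimedean[of "x - y"] by simp
qed

lemma norm_le_scale_unit:
  assumes "- (l *\<^sub>R e) \<le> x" "x \<le> l *\<^sub>R e" "0 \<le> l"
  shows "norm x \<le> l"
proof (rule field_le_epsilon)
  fix d :: real assume "0 < d"
  \<comment> \<open>The norm is an infimum over strictly positive multiples, whereas
    \<open>l\<close> may be 0.\<close>
  then have "l + d \<in> {l. 0 < l \<and> - (l *\<^sub>R e) \<le> x \<and> x \<le> l *\<^sub>R e}"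
    using assms order_trans[OF assms(2) scale_unit_mono[of l "l + d"]]
      order_trans[OF neg_scale_unit_mono[of l "l + d"] assms(1)]
    by simp
  then show "norm x \<le> l + d"
    unfolding norm_eq by (intro cInf_lower bdd_belowI[of _ 0]) auto
qed

text \<open>Every multiple larger than the norm works by definition of the infimum, and the
  Archimedean property removes the excess.\<close>

lemma le_norm_scale_unit: "x \<le> norm x *\<^sub>R e" and norm_scale_unit_le: "- (norm x *\<^sub>R e) \<le> x"
proof -
  let ?S = "{l. 0 < l \<and> - (l *\<^sub>R e) \<le> x \<and> x \<le> l *\<^sub>R e}"
  have *: "- ((norm x + d) *\<^sub>R e) \<le> x \<and> x \<le> (norm x + d) *\<^sub>R e" if "0 < d" for d
  proof -
    have "Inf ?S < norm x + d" unfolding norm_eq using that by simp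
    moreover have "?S \<noteq> {}" using order_unit[of x] by blast
    ultimately obtain l where "l \<in> ?S" "l < norm x + d" by (meson cInf_lessD)
    then show ?thesis
      using order_trans[OF _ scale_unit_mono[of l "norm x + d"]]
        order_trans[OF neg_scale_unit_mono[of l "norm x + d"]]
      by simp
  qed
  show "x \<le> norm x *\<^sub>R e"
  proof (rule le_if_le_add_scale_unit)
    fix d :: real assume "0 < d"
    from *[OF this] show "x \<le> norm x *\<^sub>R e + d *\<^sub>R e" by (simp only: scaleR_add_left)
  qed
  show "- (norm x *\<^sub>R e) \<le> x"
  proof (rule le_if_le_add_scale_unit)
    fix d :: real assume "0 < d"
    from *[OF this] have "- (norm x *\<^sub>R e) - d *\<^sub>R e \<le> x" by (simp add: scaleR_add_left)
    then show "- (norm x *\<^sub>R e) \<le> x + d *\<^sub>R e" by (simp only: diff_le_eq)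
  qed
qed

lemma norm_mono:
  fixes x y :: 'a
  assumes "0 \<le> x" "x \<le> y"
  shows "norm x \<le> norm y"
proof (rule norm_le_scale_unit[of "norm y"])
  show "- (norm y *\<^sub>R e) \<le> x"
    using neg_scale_unit_mono[of 0 "norm y"] assms(1)
    by (metis add.inverse_neutral norm_ge_zero order_trans scaleR_zero_left)
  show "x \<le> norm y *\<^sub>R e" using assms(2) le_norm_scale_unit[of y] by simp
qed simp

section \<open>Positive functionals\<close>

text \<open>Applying \<open>f\<close> to the positive elements \<open>norm x *\<^sub>R e - x\<close>
  and \<open>x + norm x *\<^sub>R e\<close> gives the bound \<open>f e\<close>. So positive
  functionals obtained algebraically lie in the Banach dual.\<close>

lemma bounded_linear_positive:
  fixes f :: "'a \<Rightarrow> real"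
  assumes lin: "linear f" and pos: "\<And>x. 0 \<le> x \<Longrightarrow> 0 \<le> f x"
  shows "bounded_linear f"
proof (rule bounded_linear_intro[where K = "f e"])
  show "f (x + y) = f x + f y" "f (r *\<^sub>R x) = r *\<^sub>R f x" for x y r
    using lin by (auto simp: linear_add linear_cmul)
  show "norm (f x) \<le> norm x * f e" for x
  proof -
    have "0 \<le> f (norm x *\<^sub>R e - x)" using le_norm_scale_unit[of x] by (intro pos) simp
    moreover have "0 \<le> f (x - - (norm x *\<^sub>R e))"
      using norm_scale_unit_le[of x] by (intro pos) (simp only: diff_ge_0_iff_ge)
    ultimately show ?thesis
      by (simp add: linear_add[OF lin] linear_diff[OF lin] linear_cmul[OF lin])
  qed
qed

lemma positive_linear_blinfun:
  fixes f :: "'a \<Rightarrow> real"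
  assumes lin: "linear f" and pos: "\<And>x. 0 \<le> x \<Longrightarrow> 0 \<le> f x"
  obtains \<phi> where "\<phi> \<in> dual_cone" "\<And>x. blinfun_apply \<phi> x = f x"
proof
  have "bounded_linear f" using assms by (rule bounded_linear_positive)
  then show *: "blinfun_apply (Blinfun f) x = f x" for x by (simp add: bounded_linear_Blinfun_apply)
  show "Blinfun f \<in> dual_cone" using pos by (simp add: dual_cone_def *)
qed

text \<open>The cone generates the space: \<open>x\<close> is the difference of
  \<open>x + norm x *\<^sub>R e\<close> and \<open>norm x *\<^sub>R e\<close>. The extension is the
  difference of the values of \<open>p\<close>.\<close>

lemma cone_functional_extends:
  fixes p :: "'a \<Rightarrow> real"
  assumes add: "\<And>x y. 0 \<le> x \<Longrightarrow> 0 \<le> y \<Longrightarrow> p (x + y) = p x + p y"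
    and scale: "\<And>c x. 0 \<le> c \<Longrightarrow> 0 \<le> x \<Longrightarrow> p (c *\<^sub>R x) = c * p x"
    and pos: "\<And>x. 0 \<le> x \<Longrightarrow> 0 \<le> p x"
  obtains \<phi> where "\<phi> \<in> dual_cone" "\<And>x. 0 \<le> x \<Longrightarrow> blinfun_apply \<phi> x = p x"
proof -
  define f where "f x = p (x + norm x *\<^sub>R e) - p (norm x *\<^sub>R e)" for x
  have up: "0 \<le> x + norm x *\<^sub>R e" for x
    using norm_scale_unit_le[of x] by (metis diff_ge_0_iff_ge diff_minus_eq_add)
  have un: "0 \<le> norm (x::'a) *\<^sub>R e" for x
    by (simp add: unit_nonneg scaleR_nonneg_nonneg)
  \<comment> \<open>The value is independent of the decomposition, so linearity can be checked on
    convenient ones.\<close>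
  have f_diff: "f (y - z) = p y - p z" if "0 \<le> y" "0 \<le> z" for y z
  proof -
    let ?n = "norm (y - z) *\<^sub>R e"
    have "p ((y - z + ?n) + z) = p (y - z + ?n) + p z" using up that by (intro add)
    moreover have "p (y + ?n) = p y + p ?n" using un that by (intro add)
    moreover have "(y - z + ?n) + z = y + ?n" by simp
    ultimately show ?thesis unfolding f_def by simp
  qed
  have f_pos: "f y = p y" if "0 \<le> y" for y
    using f_diff[OF that, of 0] scale[of 0 0] by simp
  have "linear f"
  proof (rule linearI)
    fix x y
    have "f ((x + norm x *\<^sub>R e + (y + norm y *\<^sub>R e)) - (norm x *\<^sub>R e + norm y *\<^sub>R e)) = f x + f y"
      using up un by (subst f_diff) (auto simp: add f_def intro: add_nonneg_nonneg)
    then show "f (x + y) = f x + f y" by (simp add: algebra_simps)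
  next
    fix c :: real and x
    show "f (c *\<^sub>R x) = c *\<^sub>R f x"
    proof (cases "0 \<le> c")
      case True
      then have nn: "0 \<le> c *\<^sub>R (x + norm x *\<^sub>R e)" "0 \<le> c *\<^sub>R (norm x *\<^sub>R e)"
        using up un by (auto simp only: scaleR_nonneg_nonneg)
      have "f (c *\<^sub>R x) = f (c *\<^sub>R (x + norm x *\<^sub>R e) - c *\<^sub>R (norm x *\<^sub>R e))"
        by (simp add: algebra_simps)
      also have "\<dots> = c * f x"
        unfolding f_diff[OF nn] by (simp only: scale[OF True up] scale[OF True un] f_def right_diff_distrib)
      finally show ?thesis by simp
    next
      case False
      then have c: "0 \<le> - c" by simp
      then have nn: "0 \<le> (- c) *\<^sub>R (x + norm x *\<^sub>R e)" "0 \<le> (- c) *\<^sub>R (norm x *\<^sub>R e)"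
        using up un by (auto simp only: scaleR_nonneg_nonneg)
      \<comment> \<open>A negative factor exchanges the two parts of the decomposition.\<close>
      have "f (c *\<^sub>R x) = f ((- c) *\<^sub>R (norm x *\<^sub>R e) - (- c) *\<^sub>R (x + norm x *\<^sub>R e))"
        by (simp add: algebra_simps)
      also have "\<dots> = (- c) * p (norm x *\<^sub>R e) - (- c) * p (x + norm x *\<^sub>R e)"
        unfolding f_diff[OF nn(2,1)] by (simp only: scale[OF c up] scale[OF c un])
      finally show ?thesis by (simp add: f_def right_diff_distrib)
    qed
  qed
  then obtain \<phi> where "\<phi> \<in> dual_cone" "\<And>x. blinfun_apply \<phi> x = f x"
    using positive_linear_blinfun[of f] f_pos pos by auto
  then show ?thesis using that f_pos by auto
qed

lemma dual_cone_antisym: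
  assumes "\<phi> \<in> dual_cone" "- \<phi> \<in> dual_cone"
  shows "\<phi> = (0 :: 'a \<Rightarrow>\<^sub>L real)"
proof (rule blinfun_eqI)
  fix x
  have z: "blinfun_apply \<phi> y = 0" if "0 \<le> y" for y
    using dual_cone_nonneg[OF assms(1) that] dual_cone_nonneg[OF assms(2) that]
    by (simp add: blinfun.minus_left)
  have "0 \<le> norm x *\<^sub>R e - x" "0 \<le> norm x *\<^sub>R e"
    using le_norm_scale_unit[of x] by (auto simp: unit_nonneg scaleR_nonneg_nonneg)
  from this[THEN z] show "blinfun_apply \<phi> x = blinfun_apply 0 x"
    by (simp add: blinfun.diff_right)
qed

text \<open>With \<open>p\<close> the positive part of \<open>\<phi> - \<psi>\<close>, the supremum
  of \<open>\<phi>\<close> and \<open>\<psi>\<close> is \<open>\<psi> + p\<close> and their infimum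
  is \<open>\<phi> - p\<close>. Conversely, the positive part is the supremum with 0.\<close>

lemma lattice_ordered_dual_iff:
  "lattice (ordered_dual :: ('a \<Rightarrow>\<^sub>L real) gorder) \<longleftrightarrow> (\<forall>\<phi> :: 'a \<Rightarrow>\<^sub>L real. \<exists>p. dual_positive_part \<phi> p)"
proof
  assume "lattice (ordered_dual :: ('a \<Rightarrow>\<^sub>L real) gorder)"
  then interpret lattice "ordered_dual :: ('a \<Rightarrow>\<^sub>L real) gorder" .
  show "\<forall>\<phi> :: 'a \<Rightarrow>\<^sub>L real. \<exists>p. dual_positive_part \<phi> p"
  proof
    fix \<phi> :: "'a \<Rightarrow>\<^sub>L real"
    obtain p where "least ordered_dual p (Upper ordered_dual {\<phi>, 0})"
      using sup_of_two_exists[of \<phi> 0] by (auto simp: ordered_dual_def)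
    then have "dual_positive_part \<phi> p"
      by (auto simp: least_def Upper_def ordered_dual_def dual_positive_part_def)
    then show "\<exists>p. dual_positive_part \<phi> p" ..
  qed
next
  assume pp: "\<forall>\<phi> :: 'a \<Rightarrow>\<^sub>L real. \<exists>p. dual_positive_part \<phi> p"
  interpret partial_order "ordered_dual :: ('a \<Rightarrow>\<^sub>L real) gorder"
  proof
    fix x y :: "'a \<Rightarrow>\<^sub>L real"
    assume "x \<sqsubseteq>\<^bsub>ordered_dual\<^esub> y" "y \<sqsubseteq>\<^bsub>ordered_dual\<^esub> x"
    then show "x .=\<^bsub>ordered_dual\<^esub> y"
      using dual_cone_antisym[of "y - x"] by (simp add: ordered_dual_def)
  next
    fix x y z :: "'a \<Rightarrow>\<^sub>L real"
    assume "x \<sqsubseteq>\<^bsub>ordered_dual\<^esub> y" "y \<sqsubseteq>\<^bsub>ordered_dual\<^esub> z"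
    then show "x \<sqsubseteq>\<^bsub>ordered_dual\<^esub> z"
      using dual_cone_add[of "y - x" "z - y"] by (simp add: ordered_dual_def)
  qed (auto simp: ordered_dual_def dual_cone_def)
  show "lattice (ordered_dual :: ('a \<Rightarrow>\<^sub>L real) gorder)"
  proof
    fix \<phi> \<psi> :: "'a \<Rightarrow>\<^sub>L real"
    obtain p where p: "dual_positive_part (\<phi> - \<psi>) p" using pp by blast
    have min: "s - p \<in> dual_cone" if "s \<in> dual_cone" "s - (\<phi> - \<psi>) \<in> dual_cone" for s
      using p that by (auto simp: dual_positive_part_def)
    have *: "p \<in> dual_cone" "p - (\<phi> - \<psi>) \<in> dual_cone"
      using p by (auto simp: dual_positive_part_def)
    have "least ordered_dual (\<psi> + p) (Upper ordered_dual {\<phi>, \<psi>})"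
      using * min[of "s - \<psi>" for s]
      by (auto simp: least_def Upper_def ordered_dual_def algebra_simps)
    then show "\<exists>s. least ordered_dual s (Upper ordered_dual {\<phi>, \<psi>})" ..
    have "greatest ordered_dual (\<phi> - p) (Lower ordered_dual {\<phi>, \<psi>})"
      using * min[of "\<phi> - s" for s]
      by (auto simp: greatest_def Lower_def ordered_dual_def algebra_simps)
    then show "\<exists>s. greatest ordered_dual s (Lower ordered_dual {\<phi>, \<psi>})" ..
  qed
qed

section \<open>Interpolation of effects\<close>

definition effects_interpolate :: bool where
  "effects_interpolate \<longleftrightarrow>
    (\<forall>a\<in>{0..e}. \<forall>b\<in>{0..e}. \<exists>c. 0 \<le> c \<and> a + b - e \<le> c \<and> c \<le> a \<and> c \<le> b)"

text \<open>The marginals determine a joint measurement from its entry \<open>c\<close> at (1, 1):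
  the others are \<open>a - c\<close>, \<open>b - c\<close> and \<open>c - (a + b - e)\<close>. The
  four inequalities say that all entries are nonnegative.\<close>

lemma compatible_iff_effects_interpolate:
  "(\<forall>a b :: nat \<Rightarrow> 'a. measurement e 2 a \<longrightarrow> measurement e 2 b \<longrightarrow> compatible 2 a 2 b)
    \<longleftrightarrow> effects_interpolate"
proof
  have sum2: "(\<Sum>j=1..2. f j) = f 1 + f 2" for f :: "nat \<Rightarrow> 'a"
    by (simp add: numeral_2_eq_2)
  have ball2: "(\<forall>j\<in>{1..2::nat}. P j) \<longleftrightarrow> P 1 \<and> P 2" for P
    by (auto simp: numeral_2_eq_2 le_Suc_eq)
  {
    assume comp: "\<forall>a b :: nat \<Rightarrow> 'a. measurement e 2 a \<longrightarrow> measurement e 2 b \<longrightarrow> compatible 2 a 2 b"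
    show effects_interpolate
      unfolding effects_interpolate_def
    proof (intro ballI)
      fix a b assume ab: "a \<in> {0..e}" "b \<in> {0..e}"
      define A where "A = (\<lambda>j::nat. if j = 1 then a else e - a)"
      define B where "B = (\<lambda>j::nat. if j = 1 then b else e - b)"
      have "measurement e 2 A" "measurement e 2 B"
        unfolding measurement_def ball2 sum2 using ab by (auto simp: A_def B_def)
      with comp have "compatible 2 A 2 B" by blast
      then obtain c where c: "\<forall>j\<in>{1..2}. \<forall>k\<in>{1..2}. 0 \<le> c j k"
          "\<forall>j\<in>{1..2}. A j = (\<Sum>k'=1..2. c j k')" "\<forall>k\<in>{1..2}. B k = (\<Sum>j'=1..2. c j' k)"
        unfolding compatible_def by blast
      have pos: "0 \<le> c 1 1" "0 \<le> c 1 2" "0 \<le> c 2 1" "0 \<le> c 2 2"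
        using c(1) unfolding ball2 by auto
      have rows: "a = c 1 1 + c 1 2" "e - a = c 2 1 + c 2 2"
        using c(2) unfolding ball2 sum2 by (auto simp: A_def)
      have cols: "b = c 1 1 + c 2 1"
        using c(3) unfolding ball2 sum2 by (auto simp: B_def)
      have "e = c 1 1 + c 1 2 + (c 2 1 + c 2 2)" using rows by (metis add_diff_cancel_left' diff_add_cancel add.commute)
      then have "a + b - e = c 1 1 - c 2 2" using rows(1) cols by (simp add: algebra_simps)
      then have "a + b - e \<le> c 1 1" using pos(4) by simp
      then show "\<exists>c. 0 \<le> c \<and> a + b - e \<le> c \<and> c \<le> a \<and> c \<le> b"
        using pos rows(1) cols by (intro exI[of _ "c 1 1"]) simp
    qed
  next
    assume int: effects_interpolate
    show "\<forall>a b :: nat \<Rightarrow> 'a. measurement e 2 a \<longrightarrow> measurement e 2 b \<longrightarrow> compatible 2 a 2 b"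
    proof (intro allI impI)
      fix a b :: "nat \<Rightarrow> 'a"
      assume "measurement e 2 a" "measurement e 2 b"
      then have a: "0 \<le> a 1" "0 \<le> a 2" "a 1 + a 2 = e" and b: "0 \<le> b 1" "0 \<le> b 2" "b 1 + b 2 = e"
        unfolding measurement_def ball2 sum2 by auto
      have "a 1 \<le> e" "b 1 \<le> e" using a b by (metis add_increasing2 order_refl)+
      then obtain c where c: "0 \<le> c" "a 1 + b 1 - e \<le> c" "c \<le> a 1" "c \<le> b 1"
        using int a(1) b(1) unfolding effects_interpolate_def by force
      define C where "C = (\<lambda>(j::nat) (k::nat). if j = 1 then (if k = 1 then c else a 1 - c)
          else (if k = 1 then b 1 - c else c - (a 1 + b 1 - e)))"
      show "compatible 2 a 2 b"
        unfolding compatible_def ball2 sum2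
      proof (intro exI[of _ C] conjI)
        show "a 2 = C 2 1 + C 2 2" "b 2 = C 1 2 + C 2 2"
          using a(3) b(3) by (auto simp: C_def algebra_simps)
      qed (use c in \<open>auto simp: C_def\<close>)
    qed
  }
qed

section \<open>Positive parts from interpolation\<close>

text \<open>An interpolant for \<open>a\<close> and \<open>inverse l *\<^sub>R b\<close> is scaled
  by \<open>l\<close>; its lower bound \<open>a + inverse l *\<^sub>R b - e\<close> becomes the
  estimate of \<open>b - c\<close>.\<close>

lemma scaled_interpolation:
  assumes effects_interpolate and a: "a \<in> {0..e}" and b: "0 \<le> b" "b \<le> l *\<^sub>R e" and l: "0 < l"
  obtains c where "0 \<le> c" "c \<le> l *\<^sub>R a" "c \<le> b" "b - c \<le> l *\<^sub>R (e - a)"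
proof -
  have "inverse l *\<^sub>R b \<le> inverse l *\<^sub>R (l *\<^sub>R e)" using b l by (intro scaleR_left_mono) auto
  then have "inverse l *\<^sub>R b \<le> e" using l by simp
  moreover have "0 \<le> inverse l *\<^sub>R b" using b l by (intro scaleR_nonneg_nonneg) auto
  ultimately have "inverse l *\<^sub>R b \<in> {0..e}" by simp
  then obtain c where c: "0 \<le> c" "a + inverse l *\<^sub>R b - e \<le> c" "c \<le> a" "c \<le> inverse l *\<^sub>R b"
    using assms(1) a unfolding effects_interpolate_def by blast
  have lb: "l *\<^sub>R (inverse l *\<^sub>R b) = b" using l by simp
  show ?thesis
  proof
    show "0 \<le> l *\<^sub>R c" using c l by (intro scaleR_nonneg_nonneg) auto
    show "l *\<^sub>R c \<le> l *\<^sub>R a" using c l by (intro scaleR_left_mono) auto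
    have "l *\<^sub>R c \<le> l *\<^sub>R (inverse l *\<^sub>R b)" using c l by (intro scaleR_left_mono) auto
    then show "l *\<^sub>R c \<le> b" unfolding lb .
    have "inverse l *\<^sub>R b - c \<le> e - a" using c(2) by (simp add: algebra_simps)
    then have "l *\<^sub>R (inverse l *\<^sub>R b - c) \<le> l *\<^sub>R (e - a)" using l by (intro scaleR_left_mono) auto
    then show "b - l *\<^sub>R c \<le> l *\<^sub>R (e - a)" unfolding scaleR_diff_right[of l "inverse l *\<^sub>R b"] lb .
  qed
qed

section \<open>The Riesz-Kantorovich functional\<close>

context
  fixes \<phi> :: "'a \<Rightarrow>\<^sub>L real"
begin

text \<open>The Riesz-Kantorovich formula for the positive part of \<open>\<phi>\<close>, meaningful
  for \<open>0 \<le> b\<close>.\<close>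

definition interval_sup :: "'a \<Rightarrow> real" where
  "interval_sup b = (SUP d\<in>{0..b}. blinfun_apply \<phi> d)"

lemma interval_sup_upper:
  assumes "0 \<le> d" "d \<le> b"
  shows "blinfun_apply \<phi> d \<le> interval_sup b"
  unfolding interval_sup_def
proof (rule cSUP_upper)
  show "bdd_above (blinfun_apply \<phi> ` {0..b})"
  proof (rule bdd_aboveI2)
    fix d assume "d \<in> {0..b}"
    then have "norm d \<le> norm b" by (auto intro: norm_mono)
    then have "norm \<phi> * norm d \<le> norm \<phi> * norm b" by (intro mult_left_mono) auto
    then show "blinfun_apply \<phi> d \<le> norm \<phi> * norm b"
      using norm_blinfun[of \<phi> d] by simp
  qed
qed (use assms in auto)

lemma interval_sup_least:
  assumes "0 \<le> b" "\<And>d. 0 \<le> d \<Longrightarrow> d \<le> b \<Longrightarrow> blinfun_apply \<phi> d \<le> u"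
  shows "interval_sup b \<le> u"
  unfolding interval_sup_def using assms by (intro cSUP_least) auto

lemma interval_sup_nonneg: "0 \<le> b \<Longrightarrow> 0 \<le> interval_sup b"
  using interval_sup_upper[of 0 b] by (simp add: blinfun.zero_right)

lemma interval_sup_add_ge:
  assumes "0 \<le> b" "0 \<le> b'"
  shows "interval_sup b + interval_sup b' \<le> interval_sup (b + b')"
proof -
  have *: "blinfun_apply \<phi> d + blinfun_apply \<phi> d' \<le> interval_sup (b + b')"
    if "0 \<le> d" "d \<le> b" "0 \<le> d'" "d' \<le> b'" for d d'
    unfolding blinfun.add_right[symmetric] using that
    by (intro interval_sup_upper add_mono add_nonneg_nonneg)
  have "interval_sup b \<le> interval_sup (b + b') - blinfun_apply \<phi> d'" if "0 \<le> d'" "d' \<le> b'" for d'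
    using *[OF _ _ that] by (intro interval_sup_least assms) (simp add: algebra_simps)
  then have "interval_sup b' \<le> interval_sup (b + b') - interval_sup b"
    by (intro interval_sup_least assms) (simp add: algebra_simps)
  then show ?thesis by simp
qed

text \<open>If \<open>a\<close> nearly maximises \<open>\<phi>\<close> on \<open>{0..e}\<close> and \<open>ci\<close> is the part of \<open>bi\<close> below a multiple of
  \<open>a\<close>, then replacing \<open>c1 + c2\<close> inside \<open>a\<close> by any \<open>d \<le> b1 + b2\<close> (after scaling) yields another
  effect, so \<open>\<phi> d\<close> cannot exceed \<open>\<phi> (c1 + c2)\<close> by much.\<close>

lemma interval_sup_add_le:
  assumes int: effects_interpolate and b: "0 \<le> b1" "0 \<le> b2"
  shows "interval_sup (b1 + b2) \<le> interval_sup b1 + interval_sup b2"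
proof (rule field_le_epsilon)
  fix \<epsilon> :: real assume eps: "0 < \<epsilon>"
  define l where "l = norm b1 + norm b2 + 1"
  have l: "0 < l" by (simp add: l_def add_nonneg_pos)
  have bl: "b1 \<le> l *\<^sub>R e" "b2 \<le> l *\<^sub>R e"
    using order_trans[OF le_norm_scale_unit[of b1] scale_unit_mono[of _ l]]
      order_trans[OF le_norm_scale_unit[of b2] scale_unit_mono[of _ l]]
    by (auto simp: l_def)
  \<comment> \<open>The competing effect arises from division by \<open>2 * l\<close>, so a gap of
    \<open>\<delta>\<close> grows to \<open>\<epsilon>\<close> on scaling back.\<close>
  define \<delta> where "\<delta> = \<epsilon> / (2 * l)"
  have delta: "0 < \<delta>" using eps l by (simp add: \<delta>_def)
  have "\<exists>a\<in>{0..e}. interval_sup e - \<delta> \<le> blinfun_apply \<phi> a"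
  proof (rule ccontr)
    assume "\<not> ?thesis"
    then have "interval_sup e \<le> interval_sup e - \<delta>"
      by (intro interval_sup_least unit_nonneg) (force simp: not_le)
    then show False using delta by simp
  qed
  then obtain a where a: "a \<in> {0..e}" "interval_sup e - \<delta> \<le> blinfun_apply \<phi> a" by blast
  obtain c1 where c1: "0 \<le> c1" "c1 \<le> l *\<^sub>R a" "c1 \<le> b1" "b1 - c1 \<le> l *\<^sub>R (e - a)"
    using scaled_interpolation[OF int a(1) b(1) bl(1) l] by blast
  obtain c2 where c2: "0 \<le> c2" "c2 \<le> l *\<^sub>R a" "c2 \<le> b2" "b2 - c2 \<le> l *\<^sub>R (e - a)"
    using scaled_interpolation[OF int a(1) b(2) bl(2) l] by blast
  show "interval_sup (b1 + b2) \<le> interval_sup b1 + interval_sup b2 + \<epsilon>"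
  proof (rule interval_sup_least)
    show "0 \<le> b1 + b2" using b by simp
    fix d assume d: "0 \<le> d" "d \<le> b1 + b2"
    \<comment> \<open>In \<open>(2 * l) *\<^sub>R a\<close> the part \<open>c1 + c2\<close> is
      replaced by \<open>d\<close>. The result stays below \<open>(2 * l) *\<^sub>R e\<close>
      because \<open>b1 - c1\<close> and \<open>b2 - c2\<close> each fit below
      \<open>l *\<^sub>R (e - a)\<close>.\<close>
    define g where "g = (2 * l) *\<^sub>R a - (c1 + c2) + d"
    have two: "(2 * l) *\<^sub>R x = l *\<^sub>R x + l *\<^sub>R x" for x :: 'a
      by (simp flip: scaleR_add_left)
    have "c1 + c2 \<le> (2 * l) *\<^sub>R a" unfolding two using c1 c2 by (intro add_mono)
    then have g0: "0 \<le> g" unfolding g_def using d(1) by (intro add_nonneg_nonneg) simp_all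
    have "d - (c1 + c2) \<le> (b1 - c1) + (b2 - c2)" using d(2) by (simp add: algebra_simps)
    also have "\<dots> \<le> (2 * l) *\<^sub>R (e - a)" unfolding two using c1 c2 by (intro add_mono)
    finally have "g \<le> (2 * l) *\<^sub>R e" by (simp add: g_def scaleR_diff_right algebra_simps)
    then have "inverse (2 * l) *\<^sub>R g \<le> inverse (2 * l) *\<^sub>R ((2 * l) *\<^sub>R e)"
      using l by (intro scaleR_left_mono) auto
    then have "inverse (2 * l) *\<^sub>R g \<le> e" using l by simp
    moreover have "0 \<le> inverse (2 * l) *\<^sub>R g" using l g0 by (intro scaleR_nonneg_nonneg) auto
    ultimately have "blinfun_apply \<phi> (inverse (2 * l) *\<^sub>R g) \<le> interval_sup e"
      by (intro interval_sup_upper)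
    then have "blinfun_apply \<phi> (inverse (2 * l) *\<^sub>R g) \<le> blinfun_apply \<phi> a + \<delta>" using a(2) by simp
    then have "blinfun_apply \<phi> g \<le> 2 * l * blinfun_apply \<phi> a + \<epsilon>"
      using l by (simp add: blinfun.scaleR_right \<delta>_def field_simps)
    then have "blinfun_apply \<phi> d \<le> blinfun_apply \<phi> c1 + blinfun_apply \<phi> c2 + \<epsilon>"
      by (simp add: g_def blinfun.scaleR_right blinfun.add_right blinfun.diff_right)
    then show "blinfun_apply \<phi> d \<le> interval_sup b1 + interval_sup b2 + \<epsilon>"
      using interval_sup_upper[OF c1(1,3)] interval_sup_upper[OF c2(1,3)] by simp
  qed
qed

lemma interval_sup_scale_le:
  assumes "0 < c" "0 \<le> b"
  shows "interval_sup (c *\<^sub>R b) \<le> c * interval_sup b"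
proof (rule interval_sup_least)
  show "0 \<le> c *\<^sub>R b" using assms by (simp add: scaleR_nonneg_nonneg)
  fix d assume d: "0 \<le> d" "d \<le> c *\<^sub>R b"
  have "inverse c *\<^sub>R d \<le> inverse c *\<^sub>R (c *\<^sub>R b)" using assms d by (intro scaleR_left_mono) auto
  then have "blinfun_apply \<phi> (inverse c *\<^sub>R d) \<le> interval_sup b"
    using assms d by (intro interval_sup_upper) (auto intro: scaleR_nonneg_nonneg)
  then show "blinfun_apply \<phi> d \<le> c * interval_sup b"
    using assms by (simp add: blinfun.scaleR_right field_simps)
qed

lemma interval_sup_scale:
  assumes "0 \<le> c" "0 \<le> b"
  shows "interval_sup (c *\<^sub>R b) = c * interval_sup b"
proof (cases "c = 0")
  case True
  then show ?thesis by (simp add: interval_sup_def blinfun.zero_right)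
next
  case False
  then have c: "0 < c" using assms by simp
  have "interval_sup (inverse c *\<^sub>R (c *\<^sub>R b)) \<le> inverse c * interval_sup (c *\<^sub>R b)"
    using assms c by (intro interval_sup_scale_le) (auto intro: scaleR_nonneg_nonneg)
  then have "c * interval_sup b \<le> interval_sup (c *\<^sub>R b)" using c by (simp add: field_simps)
  then show ?thesis using interval_sup_scale_le[OF c assms(2)] by simp
qed

text \<open>The extension of \<open>interval_sup\<close> is least: if \<open>s\<close> dominates 0
  and \<open>\<phi>\<close>, then \<open>\<phi> d \<le> s d \<le> s b\<close> for all
  \<open>d\<close> in \<open>{0..b}\<close>.\<close>

lemma dual_positive_part_exists:
  assumes effects_interpolate
  shows "\<exists>p. dual_positive_part \<phi> p"
proof -
  obtain p where p: "p \<in> dual_cone" "\<And>x. 0 \<le> x \<Longrightarrow> blinfun_apply p x = interval_sup x"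
  proof (rule cone_functional_extends)
    show "interval_sup (x + y) = interval_sup x + interval_sup y" if "0 \<le> x" "0 \<le> y" for x y
      using that interval_sup_add_le[OF assms that] interval_sup_add_ge[OF that] by simp
  qed (use interval_sup_scale interval_sup_nonneg in auto)
  have "p - \<phi> \<in> dual_cone"
    using interval_sup_upper by (auto simp: dual_cone_def p(2) blinfun.diff_left)
  moreover have "s - p \<in> dual_cone" if s: "s \<in> dual_cone" "s - \<phi> \<in> dual_cone" for s
  proof -
    have "interval_sup b \<le> blinfun_apply s b" if "0 \<le> b" for b
    proof (rule interval_sup_least[OF that])
      fix d assume d: "0 \<le> d" "d \<le> b"
      have "blinfun_apply \<phi> d \<le> blinfun_apply s d"
        using dual_cone_nonneg[OF s(2) d(1)] by (simp add: blinfun.diff_left)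
      also have "\<dots> \<le> blinfun_apply s b" by (rule dual_cone_mono[OF s(1) d(2)])
      finally show "blinfun_apply \<phi> d \<le> blinfun_apply s b" .
    qed
    then show ?thesis by (auto simp: dual_cone_def p(2) blinfun.diff_left)
  qed
  ultimately show ?thesis using p(1) by (auto simp: dual_positive_part_def)
qed

end

section \<open>Interpolation from a lattice-ordered dual\<close>

text \<open>\<open>t\<close> is the error of \<open>c\<close> as an interpolant, in multiples of
  \<open>e\<close>. One common error makes the condition stable under sums and positive multiples,
  so that the infimal error is sublinear.\<close>

definition interpolates_upto :: "real \<Rightarrow> 'a \<Rightarrow> 'a \<Rightarrow> 'a \<Rightarrow> 'a \<Rightarrow> 'a \<Rightarrow> bool" where
  "interpolates_upto t x1 x2 y1 y2 c \<longleftrightarrow>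
    x1 \<le> c + t *\<^sub>R e \<and> x2 \<le> c + t *\<^sub>R e \<and> c \<le> y1 + t *\<^sub>R e \<and> c \<le> y2 + t *\<^sub>R e"

lemma interpolates_upto_mono:
  assumes "interpolates_upto s x1 x2 y1 y2 c" "s \<le> t"
  shows "interpolates_upto t x1 x2 y1 y2 c"
  using assms(1) add_left_mono[OF scale_unit_mono[OF assms(2)]]
  unfolding interpolates_upto_def by (meson order_trans)

lemma interpolates_upto_add:
  assumes "interpolates_upto s x1 x2 y1 y2 c" "interpolates_upto t x1' x2' y1' y2' c'"
  shows "interpolates_upto (s + t) (x1 + x1') (x2 + x2') (y1 + y1') (y2 + y2') (c + c')"
proof -
  have *: "u + u' \<le> (v + v') + (s + t) *\<^sub>R e" if "u \<le> v + s *\<^sub>R e" "u' \<le> v' + t *\<^sub>R e" for u u' v v'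
    using add_mono[OF that] by (simp add: algebra_simps)
  show ?thesis using assms unfolding interpolates_upto_def by (elim conjE, intro conjI *)
qed

lemma interpolates_upto_scale:
  assumes "interpolates_upto t x1 x2 y1 y2 c" "0 < r"
  shows "interpolates_upto (r * t) (r *\<^sub>R x1) (r *\<^sub>R x2) (r *\<^sub>R y1) (r *\<^sub>R y2) (r *\<^sub>R c)"
proof -
  have *: "r *\<^sub>R u \<le> r *\<^sub>R v + (r * t) *\<^sub>R e" if "u \<le> v + t *\<^sub>R e" for u v
    using scaleR_left_mono[OF that, of r] assms(2) by (simp add: scaleR_add_right)
  show ?thesis using assms(1) unfolding interpolates_upto_def by (elim conjE, intro conjI *)
qed

text \<open>The candidate 0 always has a finite error, so the defect is an infimum over a nonempty
  set.\<close>

lemma interpolates_upto_norm: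
  "interpolates_upto (norm x1 + norm x2 + norm y1 + norm y2) x1 x2 y1 y2 0"
proof -
  have *: "x \<le> t *\<^sub>R e" "0 \<le> x + t *\<^sub>R e" if "norm x \<le> t" for x t
  proof -
    show "x \<le> t *\<^sub>R e" using le_norm_scale_unit[of x] scale_unit_mono[OF that] by (rule order_trans)
    have "- (t *\<^sub>R e) \<le> x" using neg_scale_unit_mono[OF that] norm_scale_unit_le[of x] by (rule order_trans)
    then show "0 \<le> x + t *\<^sub>R e" by (metis diff_ge_0_iff_ge diff_minus_eq_add)
  qed
  show ?thesis unfolding interpolates_upto_def add_0_left
    by (intro conjI *) (simp_all add: add_nonneg_nonneg)
qed

text \<open>The defect of interpolation is a sublinear functional of \<open>(x1, x2, y1, y2)\<close>. A linear
  functional below it has the form \<open>\<phi>1 x1 + \<phi>2 x2 - \<psi>1 y1 - \<psi>2 y2\<close> with positive entries and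
  \<open>\<phi>1 + \<phi>2 = \<psi>1 + \<psi>2\<close>, so that \<open>dual_pairing_le\<close> applies.\<close>

lemma approximate_interpolation:
  assumes pp: "\<And>\<phi> :: 'a \<Rightarrow>\<^sub>L real. \<exists>p. dual_positive_part \<phi> p"
    and le: "x1 \<le> y1" "x1 \<le> y2" "x2 \<le> y1" "x2 \<le> y2" and eps: "0 < \<epsilon>"
  obtains c where "interpolates_upto \<epsilon> x1 x2 y1 y2 c"
proof -
  define S where "S = (\<lambda>(u1, u2, v1, v2). {t. 0 \<le> t \<and> (\<exists>c. interpolates_upto t u1 u2 v1 v2 c)})"
  define q where "q = (\<lambda>w. Inf (S w))"
  have bdd: "bdd_below (S w)" for w
    by (rule bdd_belowI[of _ 0]) (auto simp: S_def split: prod.splits)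
  have ne: "S w \<noteq> {}" for w
  proof -
    obtain u1 u2 v1 v2 where w: "w = (u1, u2, v1, v2)" by (cases w) auto
    have "norm u1 + norm u2 + norm v1 + norm v2 \<in> S w"
      using interpolates_upto_norm[of u1 u2 v1 v2] by (auto simp: S_def w)
    then show ?thesis by blast
  qed
  have sub: "sublinear q"
    unfolding q_def
  proof (rule sublinear_Inf[OF ne bdd])
    show "0 \<in> S 0"
      by (auto simp: S_def zero_prod_def interpolates_upto_def intro!: exI[of _ 0])
    show "0 \<le> s" if "s \<in> S 0" for s
      using that by (auto simp: S_def zero_prod_def)
    show "\<exists>r\<in>S (w + w'). r \<le> s + t" if st: "s \<in> S w" "t \<in> S w'" for w w' s t
    proof -
      have "s + t \<in> S (w + w')"
        using st interpolates_upto_add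
        by (cases w; cases w') (fastforce simp: S_def)
      then show ?thesis by blast
    qed
    show "\<exists>r\<in>S (c *\<^sub>R w). r \<le> c * t" if ct: "0 < c" "t \<in> S w" for c w t
    proof -
      have "c * t \<in> S (c *\<^sub>R w)"
        using ct interpolates_upto_scale[OF _ ct(1)]
        by (cases w) (fastforce simp: S_def)
      then show ?thesis by blast
    qed
  qed
  have q_le: "q (u1, u2, v1, v2) \<le> 0" if "interpolates_upto 0 u1 u2 v1 v2 c" for u1 u2 v1 v2 c
    unfolding q_def using that by (intro cInf_lower bdd) (auto simp: S_def)
  obtain f where f: "linear f" "\<And>w. f w \<le> q w" "f (x1, x2, y1, y2) = q (x1, x2, y1, y2)"
    using Hahn_Banach_sublinear[OF sub] by blast
  have f_le: "f (u1, u2, v1, v2) \<le> 0" if "interpolates_upto 0 u1 u2 v1 v2 c" for u1 u2 v1 v2 c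
    using f(2) q_le[OF that] by (rule order_trans)
  have f_neg: "f (- w) = - f w" for w by (rule linear_neg[OF f(1)])
  have lin_comp: "linear (\<lambda>u. f (i u))" if "linear i" for i :: "'a \<Rightarrow> 'a \<times> 'a \<times> 'a \<times> 'a"
    using linear_compose[OF that f(1)] by (simp add: o_def)
  have lin: "linear (\<lambda>u. f (u, 0, 0, 0))" "linear (\<lambda>u. f (0, u, 0, 0))"
    by (intro lin_comp linearI; simp)+
  have lin': "linear (\<lambda>v. - f (0, 0, v, 0))" "linear (\<lambda>v. - f (0, 0, 0, v))"
    by (intro linear_compose_neg lin_comp linearI; simp)+
  \<comment> \<open>Lowering a lower bound or raising an upper bound of the zero tuple leaves 0 an
    exact interpolant; this fixes the four signs.\<close>
  have pos: "0 \<le> f (u, 0, 0, 0)" "0 \<le> f (0, u, 0, 0)" "0 \<le> - f (0, 0, u, 0)" "0 \<le> - f (0, 0, 0, u)"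
    if "0 \<le> u" for u
    using that f_le[of "- u" 0 0 0 0] f_le[of 0 "- u" 0 0 0] f_le[of 0 0 u 0 0] f_le[of 0 0 0 u 0]
      f_neg[of "(u, 0, 0, 0)"] f_neg[of "(0, u, 0, 0)"]
    by (auto simp: interpolates_upto_def)
  obtain \<phi>1 where \<phi>1: "\<phi>1 \<in> dual_cone" "\<And>u. blinfun_apply \<phi>1 u = f (u, 0, 0, 0)"
    using positive_linear_blinfun[OF lin(1) pos(1)] by blast
  obtain \<phi>2 where \<phi>2: "\<phi>2 \<in> dual_cone" "\<And>u. blinfun_apply \<phi>2 u = f (0, u, 0, 0)"
    using positive_linear_blinfun[OF lin(2) pos(2)] by blast
  obtain \<psi>1 where \<psi>1: "\<psi>1 \<in> dual_cone" "\<And>v. blinfun_apply \<psi>1 v = - f (0, 0, v, 0)"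
    using positive_linear_blinfun[OF lin'(1) pos(3)] by blast
  obtain \<psi>2 where \<psi>2: "\<psi>2 \<in> dual_cone" "\<And>v. blinfun_apply \<psi>2 v = - f (0, 0, 0, v)"
    using positive_linear_blinfun[OF lin'(2) pos(4)] by blast
  have f_eq: "f (u1, u2, v1, v2) = blinfun_apply \<phi>1 u1 + blinfun_apply \<phi>2 u2
      - blinfun_apply \<psi>1 v1 - blinfun_apply \<psi>2 v2" for u1 u2 v1 v2
    by (simp add: \<phi>1(2) \<phi>2(2) \<psi>1(2) \<psi>2(2) flip: linear_add[OF f(1)])
  \<comment> \<open>A constant tuple and its negative both have exact interpolants.\<close>
  have "f (u, u, u, u) = 0" for u
    using f_le[of u u u u u] f_le[of "- u" "- u" "- u" "- u" "- u"] f_neg[of "(u, u, u, u)"]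
    by (auto simp: interpolates_upto_def)
  then have sum: "\<phi>1 + \<phi>2 = \<psi>1 + \<psi>2"
    by (intro blinfun_eqI) (simp add: f_eq blinfun.add_left algebra_simps)
  obtain p where p: "dual_positive_part (\<phi>1 - \<psi>1) p" using pp by blast
  \<comment> \<open>As \<open>f\<close> was chosen to agree with \<open>q\<close> at this tuple, the
    pairing inequality bounds the defect itself.\<close>
  have "q (x1, x2, y1, y2) \<le> 0"
    using dual_pairing_le[OF p \<phi>1(1) \<phi>2(1) \<psi>1(1) \<psi>2(1) sum le] by (simp add: f(3)[symmetric] f_eq)
  then have "Inf (S (x1, x2, y1, y2)) < \<epsilon>" using eps by (simp add: q_def)
  then obtain t where "t \<in> S (x1, x2, y1, y2)" "t < \<epsilon>" using cInf_lessD[OF ne] by blast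
  then obtain c where "interpolates_upto t x1 x2 y1 y2 c" "t \<le> \<epsilon>" by (auto simp: S_def)
  then show ?thesis using interpolates_upto_mono that by blast
qed

section \<open>Improving an interpolant and passing to the limit\<close>

text \<open>Each of \<open>x1\<close>, \<open>x2\<close>, \<open>z - \<epsilon> *\<^sub>R e\<close>
  lies below each of \<open>y1\<close>, \<open>y2\<close>,
  \<open>z + \<epsilon> *\<^sub>R e\<close>. Four approximate interpolations of pairs interpolate
  between these triples, which keeps \<open>z'\<close> near \<open>z\<close>.\<close>

lemma approximate_interpolation_near:
  assumes pp: "\<And>\<phi> :: 'a \<Rightarrow>\<^sub>L real. \<exists>p. dual_positive_part \<phi> p"
    and le: "x1 \<le> y1" "x1 \<le> y2" "x2 \<le> y1" "x2 \<le> y2"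
    and z: "interpolates_upto \<epsilon> x1 x2 y1 y2 z" and eps: "0 < \<epsilon>" and delta: "0 < \<delta>"
  obtains z' where "interpolates_upto \<delta> x1 x2 y1 y2 z'" "norm (z' - z) \<le> \<epsilon> + \<delta>"
proof -
  \<comment> \<open>The largest accumulated error, from \<open>x1\<close> or \<open>x2\<close>
    through \<open>b\<close> to \<open>h\<close>, is \<open>2 * d + 4 * d\<close>.\<close>
  define d where "d = \<delta> / 6"
  have d: "0 < d" using delta by (simp add: d_def)
  define le where "le = (\<lambda>t u v. u \<le> v + t *\<^sub>R e)"
  have le_trans: "le (s + t) u w" if "le s u v" "le t v w" for s t u v w
  proof -
    have "u \<le> v + s *\<^sub>R e" "v \<le> w + t *\<^sub>R e" using that by (simp_all add: le_def)
    then have "u \<le> (w + t *\<^sub>R e) + s *\<^sub>R e" by (meson add_right_mono order_trans)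
    then show ?thesis by (simp add: le_def algebra_simps)
  qed
  have le_mono: "le t u v" if "le s u v" "s \<le> t" for s t u v
    using that(1) add_left_mono[OF scale_unit_mono[OF that(2)]] unfolding le_def by (rule order_trans)
  \<comment> \<open>The inherited error \<open>s\<close> is absorbed by lowering \<open>u1\<close>
    and \<open>u2\<close>, so the upper inequalities have error \<open>d\<close> only.\<close>
  have step: "\<exists>c. le (s + d) u1 c \<and> le (s + d) u2 c \<and> le d c v1 \<and> le d c v2"
    if "le s u1 v1" "le s u1 v2" "le s u2 v1" "le s u2 v2" for s u1 u2 v1 v2
  proof -
    have "u1 - s *\<^sub>R e \<le> v1" "u1 - s *\<^sub>R e \<le> v2" "u2 - s *\<^sub>R e \<le> v1" "u2 - s *\<^sub>R e \<le> v2"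
      using that by (auto simp: le_def diff_le_eq)
    then obtain c where "interpolates_upto d (u1 - s *\<^sub>R e) (u2 - s *\<^sub>R e) v1 v2 c"
      by (rule approximate_interpolation[OF pp _ _ _ _ d])
    then show ?thesis by (auto simp: interpolates_upto_def le_def algebra_simps)
  qed
  define l u where "l = z - \<epsilon> *\<^sub>R e" and "u = z + \<epsilon> *\<^sub>R e"
  have z': "le 0 x1 u" "le 0 x2 u" "le 0 l y1" "le 0 l y2"
    using z by (auto simp: interpolates_upto_def le_def l_def u_def algebra_simps)
  have lu: "le 0 l u"
    using neg_scale_unit_mono[of "- \<epsilon>" \<epsilon>] eps by (simp add: le_def l_def u_def)
  \<comment> \<open>Up to errors, \<open>a\<close> separates the two given pairs, \<open>b\<close>
    lies above \<open>x1\<close>, \<open>x2\<close> and below \<open>a\<close>, \<open>u\<close>,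
    then \<open>g\<close> lies above \<open>b\<close>, \<open>l\<close> and below \<open>y1\<close>,
    \<open>y2\<close>. Finally \<open>h\<close> lies above \<open>b\<close>, \<open>l\<close> and
    below \<open>g\<close>, \<open>u\<close>, hence between both triples.\<close>
  obtain a where a: "le d x1 a" "le d x2 a" "le d a y1" "le d a y2"
    using step[of 0 x1 y1 y2 x2] le by (auto simp: le_def)
  obtain b where b: "le (d + d) x1 b" "le (d + d) x2 b" "le d b a" "le d b u"
    using step[of d x1 a u x2] a le_mono[OF z'(1), of d] le_mono[OF z'(2), of d] d by auto
  have b_y: "le (d + d) b y1" "le (d + d) b y2" using b(3) a(3,4) le_trans by blast+
  obtain g where g: "le (d + d + d) b g" "le (d + d + d) l g" "le d g y1" "le d g y2"
    using step[of "d + d" b y1 y2 l] b_y le_mono[OF z'(3), of "d + d"] le_mono[OF z'(4), of "d + d"] d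
    by auto
  obtain h where h: "le (d + d + d + d) b h" "le (d + d + d + d) l h" "le d h g" "le d h u"
    using step[of "d + d + d" b g u l] g le_mono[OF b(4), of "d + d + d"] le_mono[OF lu, of "d + d + d"] d
    by auto
  show ?thesis
  proof
    have "le \<delta> x1 h" "le \<delta> x2 h"
      using le_trans[OF b(1) h(1)] le_trans[OF b(2) h(1)] by (simp_all add: d_def)
    moreover have "le \<delta> h y1" "le \<delta> h y2"
      using le_trans[OF h(3) g(3)] le_trans[OF h(3) g(4)] delta by (auto elim!: le_mono simp: d_def)
    ultimately show "interpolates_upto \<delta> x1 x2 y1 y2 h"
      by (auto simp: interpolates_upto_def le_def)
    have "le \<delta> h u" "le \<delta> l h" using h(2,4) delta by (auto elim!: le_mono simp: d_def)
    then have up: "h \<le> z + \<epsilon> *\<^sub>R e + \<delta> *\<^sub>R e" and low: "z - \<epsilon> *\<^sub>R e \<le> h + \<delta> *\<^sub>R e"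
      by (simp_all add: le_def l_def u_def)
    show "norm (h - z) \<le> \<epsilon> + \<delta>"
    proof (rule norm_le_scale_unit)
      have "z \<le> h + (\<epsilon> + \<delta>) *\<^sub>R e"
        using low by (simp add: algebra_simps)
      then have "z - (\<epsilon> + \<delta>) *\<^sub>R e \<le> h" by (simp only: diff_le_eq)
      then show "- ((\<epsilon> + \<delta>) *\<^sub>R e) \<le> h - z" by (simp add: le_diff_eq)
      show "h - z \<le> (\<epsilon> + \<delta>) *\<^sub>R e" using up by (simp add: algebra_simps)
    qed (use eps delta in simp)
  qed
qed

text \<open>Repeated improvement halves the error with summable steps, so completeness yields a
  limit, and the Archimedean property makes the limit an exact interpolant.\<close>

lemma interpolation:
  fixes x1 x2 y1 y2 :: 'a
  assumes pp: "\<And>\<phi> :: 'a \<Rightarrow>\<^sub>L real. \<exists>p. dual_positive_part \<phi> p"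
    and le: "x1 \<le> y1" "x1 \<le> y2" "x2 \<le> y1" "x2 \<le> y2"
  shows "\<exists>c. x1 \<le> c \<and> x2 \<le> c \<and> c \<le> y1 \<and> c \<le> y2"
proof -
  have "\<exists>z. \<forall>n. interpolates_upto ((1/2) ^ n) x1 x2 y1 y2 (z n) \<and> norm (z (Suc n) - z n) \<le> 2 * (1/2) ^ n"
  proof (rule dependent_nat_choice)
    show "\<exists>z. interpolates_upto ((1/2) ^ 0) x1 x2 y1 y2 z"
      using approximate_interpolation[OF pp le, of "(1/2) ^ 0"] by auto
    fix z and n :: nat
    assume "interpolates_upto ((1/2) ^ n) x1 x2 y1 y2 z"
    then obtain z' where z': "interpolates_upto ((1/2) ^ Suc n) x1 x2 y1 y2 z'"
        "norm (z' - z) \<le> (1/2) ^ n + (1/2) ^ Suc n"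
      using approximate_interpolation_near[OF pp le, of "(1/2) ^ n" z "(1/2) ^ Suc n"]
      by (metis half_gt_zero_iff zero_less_one zero_less_power)
    have "(1/2) ^ n + (1/2) ^ Suc n \<le> 2 * (1/2 :: real) ^ n" by simp
    then show "\<exists>z'. interpolates_upto ((1/2) ^ Suc n) x1 x2 y1 y2 z' \<and> norm (z' - z) \<le> 2 * (1/2) ^ n"
      using z' by (meson order_trans)
  qed
  then obtain z where z: "\<And>n. interpolates_upto ((1/2) ^ n) x1 x2 y1 y2 (z n)"
      "\<And>n. norm (z (Suc n) - z n) \<le> 2 * (1/2) ^ n"
    by blast
  have "summable (\<lambda>n. 2 * (1/2 :: real) ^ n)" by (intro summable_mult summable_geometric) simp
  \<comment> \<open>Completeness enters here: the steps are absolutely summable, and their partial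
    sums telescope.\<close>
  then have "summable (\<lambda>n. z (Suc n) - z n)"
    by (rule summable_comparison_test[rotated]) (use z(2) in blast)
  then have "(\<lambda>n. \<Sum>i<n. z (Suc i) - z i) \<longlonglongrightarrow> (\<Sum>n. z (Suc n) - z n)"
    by (rule summable_LIMSEQ)
  then have "(\<lambda>n. (z n - z 0) + z 0) \<longlonglongrightarrow> (\<Sum>n. z (Suc n) - z n) + z 0"
    unfolding sum_lessThan_telescope by (intro tendsto_intros)
  then obtain c where c: "z \<longlonglongrightarrow> c" by auto
  have near: "\<exists>n. (1/2) ^ n + norm (z n - c) < d" if "0 < d" for d :: real
  proof -
    have "(\<lambda>n. norm (z n - c)) \<longlonglongrightarrow> 0" using c by (simp add: LIM_zero tendsto_norm_zero)
    moreover have "(\<lambda>n. (1/2 :: real) ^ n) \<longlonglongrightarrow> 0" by (intro LIMSEQ_power_zero) simp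
    ultimately have "(\<lambda>n. (1/2) ^ n + norm (z n - c)) \<longlonglongrightarrow> 0 + 0" by (intro tendsto_add)
    then have "\<forall>\<^sub>F n in sequentially. (1/2) ^ n + norm (z n - c) < d"
      using that by (intro order_tendstoD(2)) auto
    then show ?thesis by (auto simp: eventually_sequentially)
  qed
  have lower: "x \<le> c" if x: "\<And>n. x \<le> z n + ((1/2) ^ n) *\<^sub>R e" for x
  proof (rule le_if_le_add_scale_unit)
    fix d :: real assume "0 < d"
    then obtain n where n: "(1/2) ^ n + norm (z n - c) < d" using near by blast
    have "z n \<le> c + norm (z n - c) *\<^sub>R e" using le_norm_scale_unit[of "z n - c"] by (simp add: algebra_simps)
    then have "x \<le> c + norm (z n - c) *\<^sub>R e + ((1/2) ^ n) *\<^sub>R e"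
      using x[of n] by (meson add_right_mono order_trans)
    also have "\<dots> = c + ((1/2) ^ n + norm (z n - c)) *\<^sub>R e" by (simp add: algebra_simps)
    also have "\<dots> \<le> c + d *\<^sub>R e" using n by (intro add_left_mono scale_unit_mono) simp
    finally show "x \<le> c + d *\<^sub>R e" .
  qed
  have upper: "c \<le> y" if y: "\<And>n. z n \<le> y + ((1/2) ^ n) *\<^sub>R e" for y
  proof (rule le_if_le_add_scale_unit)
    fix d :: real assume "0 < d"
    then obtain n where n: "(1/2) ^ n + norm (z n - c) < d" using near by blast
    have "c \<le> z n + norm (z n - c) *\<^sub>R e"
      using le_norm_scale_unit[of "c - z n"] by (simp add: norm_minus_commute algebra_simps)
    then have "c \<le> y + ((1/2) ^ n) *\<^sub>R e + norm (z n - c) *\<^sub>R e"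
      using y[of n] by (meson add_right_mono order_trans)
    also have "\<dots> = y + ((1/2) ^ n + norm (z n - c)) *\<^sub>R e" by (simp add: algebra_simps)
    also have "\<dots> \<le> y + d *\<^sub>R e" using n by (intro add_left_mono scale_unit_mono) simp
    finally show "c \<le> y + d *\<^sub>R e" .
  qed
  show ?thesis
    using z(1) unfolding interpolates_upto_def by (intro exI[of _ c] conjI lower upper) auto
qed

text \<open>For effects, the lower pair 0, \<open>a + b - e\<close> lies below the upper pair
  \<open>a\<close>, \<open>b\<close>; for instance \<open>a + b - e \<le> a\<close> is
  \<open>b \<le> e\<close>.\<close>

lemma effects_interpolate_iff:
  "effects_interpolate \<longleftrightarrow> (\<forall>\<phi> :: 'a \<Rightarrow>\<^sub>L real. \<exists>p. dual_positive_part \<phi> p)"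
proof
  assume pp: "\<forall>\<phi> :: 'a \<Rightarrow>\<^sub>L real. \<exists>p. dual_positive_part \<phi> p"
  show effects_interpolate
    unfolding effects_interpolate_def
  proof (intro ballI)
    fix a b assume "a \<in> {0..e}" "b \<in> {0..e}"
    then show "\<exists>c. 0 \<le> c \<and> a + b - e \<le> c \<and> c \<le> a \<and> c \<le> b"
      using pp by (intro interpolation) (auto simp: diff_le_eq add.commute add_left_mono)
  qed
qed (use dual_positive_part_exists in blast)

end

theorem theorem3:
  fixes e :: "'a::{banach, ordered_real_vector}"
  assumes "order_unit_banach_space e"
  shows "lattice (ordered_dual :: ('a \<Rightarrow>\<^sub>L real) gorder) \<longleftrightarrow>
    (\<forall>a b :: nat \<Rightarrow> 'a. measurement e 2 a \<longrightarrow> measurement e 2 b \<longrightarrow> compatible 2 a 2 b)"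
proof -
  interpret order_unit_banach_space e by (rule assms)
  show ?thesis
    by (simp only: lattice_ordered_dual_iff compatible_iff_effects_interpolate effects_interpolate_iff)
qed

end
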